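(* If $K$ is a pseudo-universal AEC, then $K$ is fully $(<\aleph_0)$-tame and short.
   Context: AEC. An abstract elementary class (AEC) is a pair $(K,\le)$ where $K$ is a class of structures in a fixed language $L(K)$, $\le$ is a partial order on $K$, both are closed under isomorphism, $M\le N$ implies $M\subseteq N$, and: (coherence) $M_0\le M_2$, $M_1\le M_2$, $M_0\subseteq M_1$ imply $M_0\le M_1$; (Tarski-Vaught) the union $M_\delta$ of a $\le$-increasing chain $\langle M_i:i<\delta\rangle$ ($\delta$ limit) is in $K$, $M_0\le M_\delta$, and if $M_i\le N$ for all $i$ then $M_\delta\le N$; (Löwenheim-Skolem-Tarski) there is a cardinal $\lambda\ge |L(K)|+\aleph_0$ such that for all $M\in K$ and $A\subseteq|M|$ there is $M_0\le M$ with $A\subseteq |M_0|$ and $\|M_0\|\le |A|+\lambda$; $\mathrm{LS}(K)$ is the least such $\lambda$. Here $|M|$ is the universe and $\|M\|$ the cardinality of $M$. A $K$-embedding $f:M\to N$ is an isomorphism of $M$ onto some $f[M]\le N$. Galois types. For $N\in K$, $A\subseteq|N|$, $\bar b$ a (possibly infinite) sequence from $N$, consider triples $(\bar b,A,N)$. Put $(\bar b_1,A,N_1)E_{\mathrm{at}}(\bar b_2,A,N_2)$ if there are $N\in K$ and $K$-embeddings $f_\ell:N_\ell\to N$ fixing $A$ pointwise with $f_1(\bar b_1)=f_2(\bar b_2)$; $E$ is the transitive closure of $E_{\mathrm{at}}$, and $\mathrm{gtp}(\bar b/A;N)$ is the $E$-class of $(\bar b,A,N)$. $\mathrm{gS}^\alpha(M)$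 is the set of all $\mathrm{gtp}(\bar b/M;N)$ with $M\le N$ and $\bar b$ of length $\alpha$. For $p=\mathrm{gtp}(\bar b/M;N)\in\mathrm{gS}^\alpha(M)$, $I\subseteq\alpha$, $A\subseteq|M|$, $p^I\restriction A:=\mathrm{gtp}(\bar b\restriction I/A;N)$. $K$ is fully $(<\kappa)$-tame and short if for any $M\in K$, ordinal $\alpha$, and $p\ne q$ in $\mathrm{gS}^\alpha(M)$ there are $I\subseteq\alpha$, $A\subseteq|M|$ with $|I|+|A|<\kappa$ and $p^I\restriction A\ne q^I\restriction A$. Pseudo-universal. For $N\in K$ and $A\subseteq|N|$, $\mathrm{cl}^N(A):=\bigcap\{|M|: M\le N, A\subseteq|M|\}$. $K$ admits intersections if for all $N\in K$ and $A\subseteq |N|$, $\mathrm{cl}^N(A)$ is the universe of some $M_0\le N$ (with which it is identified). $K$ is pseudo-universal if it admits intersections and for any $N_1,N_2,\bar a_1,\bar a_2$, if $\mathrm{gtp}(\bar a_1/\emptyset;N_1)=\mathrm{gtp}(\bar a_2/\emptyset;N_2)$ and $f,g:\mathrm{cl}^{N_1}(\bar a_1)\cong\mathrm{cl}^{N_2}(\bar a_2)$ satisfy $f(\bar a_1)=g(\bar a_1)=\bar a_2$, then $f=g$. (Every universal class, i.e. a class of structures in a fixed language closed under isomorphism, substructures and unions of $\subseteq$-increasing chains, is pseudo-universal when ordered by $\subseteq$.) *)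

theory Defs
  imports Main
begin

unbundle cardinal_syntax

text \<open>
  The type \<open>'v\<close> plays the role of the set-theoretic universe: a set is a \<open>small\<close> subset of
  \<open>'v\<close>, one of cardinality less than that of \<open>'v\<close>, and a proper class of structures is an
  arbitrary set of structures with small universes.  If the cardinality of \<open>'v\<close> is inaccessible,
  this is the usual notion inside a Grothendieck universe, but nothing of the sort is assumed.
\<close>

definition small :: "'v set \<Rightarrow> bool" where
  "small A \<longleftrightarrow> |A| <o |UNIV :: 'v set|"

text \<open>Up to isomorphism, every ordinal of the universe is a small well-order on elements of \<open>'v\<close>.\<close>

definition is_ordinal :: "'v rel \<Rightarrow> bool" where
  "is_ordinal \<alpha> \<longleftrightarrow> Well_order \<alpha> \<and> small (Field \<alpha>)"

definition is_limit_ordinal :: "'v rel \<Rightarrow> bool" where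
  "is_limit_ordinal \<delta> \<longleftrightarrow> is_ordinal \<delta> \<and> Field \<delta> \<noteq> {} \<and>
     (\<forall>i\<in>Field \<delta>. \<exists>j\<in>Field \<delta>. j \<noteq> i \<and> (i, j) \<in> \<delta>)"


subsection \<open>Languages and structures\<close>

record ('f, 'r) language =
  funs :: "'f set"
  rels :: "'r set"
  fun_arity :: "'f \<Rightarrow> nat"
  rel_arity :: "'r \<Rightarrow> nat"

record ('v, 'f, 'r) struct =
  univ :: "'v set"
  fun_interp :: "'f \<Rightarrow> 'v list \<Rightarrow> 'v"
  rel_interp :: "'r \<Rightarrow> 'v list \<Rightarrow> bool"

definition fun_args :: "('f, 'r) language \<Rightarrow> 'v set \<Rightarrow> 'f \<Rightarrow> 'v list set" where
  "fun_args L X f = (if f \<in> funs L then {xs. length xs = fun_arity L f \<and> set xs \<subseteq> X} else {})"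

definition rel_args :: "('f, 'r) language \<Rightarrow> 'v set \<Rightarrow> 'r \<Rightarrow> 'v list set" where
  "rel_args L X R = (if R \<in> rels L then {xs. length xs = rel_arity L R \<and> set xs \<subseteq> X} else {})"

text \<open>
  The values of the interpretations outside their proper domains are normalised, so that
  equality of structures is equality of records.  The empty structure is allowed.
\<close>

definition is_struct :: "('f, 'r) language \<Rightarrow> ('v, 'f, 'r) struct \<Rightarrow> bool" where
  "is_struct L M \<longleftrightarrow> small (univ M) \<and>
     (\<forall>f. \<forall>xs \<in> fun_args L (univ M) f. fun_interp M f xs \<in> univ M) \<and>
     (\<forall>f xs. xs \<notin> fun_args L (univ M) f \<longrightarrow> fun_interp M f xs = undefined) \<and>
     (\<forall>R xs. xs \<notin> rel_args L (univ M) R \<longrightarrow> \<not> rel_interp M R xs)"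

definition substruct :: "('f, 'r) language \<Rightarrow> ('v, 'f, 'r) struct \<Rightarrow> ('v, 'f, 'r) struct \<Rightarrow> bool" where
  "substruct L M N \<longleftrightarrow> univ M \<subseteq> univ N \<and>
     (\<forall>f. \<forall>xs \<in> fun_args L (univ M) f. fun_interp M f xs = fun_interp N f xs) \<and>
     (\<forall>R. \<forall>xs \<in> rel_args L (univ M) R. rel_interp M R xs \<longleftrightarrow> rel_interp N R xs)"

definition struct_iso ::
  "('f, 'r) language \<Rightarrow> ('v \<Rightarrow> 'v) \<Rightarrow> ('v, 'f, 'r) struct \<Rightarrow> ('v, 'f, 'r) struct \<Rightarrow> bool" where
  "struct_iso L h M N \<longleftrightarrow> bij_betw h (univ M) (univ N) \<and>
     (\<forall>f. \<forall>xs \<in> fun_args L (univ M) f. h (fun_interp M f xs) = fun_interp N f (map h xs)) \<and>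
     (\<forall>R. \<forall>xs \<in> rel_args L (univ M) R. rel_interp M R xs \<longleftrightarrow> rel_interp N R (map h xs))"

definition restrict_struct ::
  "('f, 'r) language \<Rightarrow> ('v, 'f, 'r) struct \<Rightarrow> 'v set \<Rightarrow> ('v, 'f, 'r) struct" where
  "restrict_struct L N X =
     \<lparr> univ = X,
       fun_interp = (\<lambda>f xs. if xs \<in> fun_args L X f then fun_interp N f xs else undefined),
       rel_interp = (\<lambda>R xs. xs \<in> rel_args L X R \<and> rel_interp N R xs) \<rparr>"

text \<open>
  Meant for families directed by \<open>substruct\<close>: every tuple of the union lies in some member, and
  all members containing it agree on it.
\<close>

definition union_struct ::
  "('f, 'r) language \<Rightarrow> 'i set \<Rightarrow> ('i \<Rightarrow> ('v, 'f, 'r) struct) \<Rightarrow> ('v, 'f, 'r) struct" where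
  "union_struct L I M =
     \<lparr> univ = (\<Union>i\<in>I. univ (M i)),
       fun_interp = (\<lambda>f xs. if xs \<in> fun_args L (\<Union>i\<in>I. univ (M i)) f
          then fun_interp (M (SOME i. i \<in> I \<and> set xs \<subseteq> univ (M i))) f xs else undefined),
       rel_interp = (\<lambda>R xs. \<exists>i\<in>I. xs \<in> rel_args L (univ (M i)) R \<and> rel_interp (M i) R xs) \<rparr>"


subsection \<open>Abstract elementary classes\<close>

record ('v, 'f, 'r) abstract_class =
  Lang :: "('f, 'r) language"
  Cls :: "('v, 'f, 'r) struct set"
  Ord :: "('v, 'f, 'r) struct rel"

abbreviation strong_sub ::
  "('v, 'f, 'r) struct \<Rightarrow> ('v, 'f, 'r) abstract_class \<Rightarrow> ('v, 'f, 'r) struct \<Rightarrow> bool"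
  ("(_ \<preceq>\<^bsub>_\<^esub> _)" [51, 0, 51] 50) where
  "M \<preceq>\<^bsub>K\<^esub> N \<equiv> (M, N) \<in> Ord K"

definition iso_closed :: "('v, 'f, 'r) abstract_class \<Rightarrow> bool" where
  "iso_closed K \<longleftrightarrow>
     (\<forall>M\<in>Cls K. \<forall>M' h. is_struct (Lang K) M' \<and> struct_iso (Lang K) h M M' \<longrightarrow> M' \<in> Cls K) \<and>
     (\<forall>M N M' N' h. M \<preceq>\<^bsub>K\<^esub> N \<and> is_struct (Lang K) M' \<and> is_struct (Lang K) N' \<and>
        substruct (Lang K) M' N' \<and> struct_iso (Lang K) h N N' \<and> struct_iso (Lang K) h M M'
        \<longrightarrow> M' \<preceq>\<^bsub>K\<^esub> N')"

definition coherence :: "('v, 'f, 'r) abstract_class \<Rightarrow> bool" where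
  "coherence K \<longleftrightarrow> (\<forall>M\<^sub>0 M\<^sub>1 M\<^sub>2. M\<^sub>0 \<preceq>\<^bsub>K\<^esub> M\<^sub>2 \<and> M\<^sub>1 \<preceq>\<^bsub>K\<^esub> M\<^sub>2 \<and> substruct (Lang K) M\<^sub>0 M\<^sub>1 \<longrightarrow> M\<^sub>0 \<preceq>\<^bsub>K\<^esub> M\<^sub>1)"

text \<open>Here \<open>z\<close> is the least element of the limit ordinal \<open>\<delta>\<close>.\<close>

definition tarski_vaught :: "('v, 'f, 'r) abstract_class \<Rightarrow> bool" where
  "tarski_vaught K \<longleftrightarrow>
     (\<forall>(\<delta> :: 'v rel) M. is_limit_ordinal \<delta> \<and> (\<forall>i\<in>Field \<delta>. M i \<in> Cls K) \<and>
        (\<forall>i j. (i, j) \<in> \<delta> \<longrightarrow> M i \<preceq>\<^bsub>K\<^esub> M j) \<longrightarrow>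
        (let M\<^sub>\<delta> = union_struct (Lang K) (Field \<delta>) M in
           M\<^sub>\<delta> \<in> Cls K \<and>
           (\<forall>z\<in>Field \<delta>. (\<forall>i\<in>Field \<delta>. (z, i) \<in> \<delta>) \<longrightarrow> M z \<preceq>\<^bsub>K\<^esub> M\<^sub>\<delta>) \<and>
           (\<forall>N\<in>Cls K. (\<forall>i\<in>Field \<delta>. M i \<preceq>\<^bsub>K\<^esub> N) \<longrightarrow> M\<^sub>\<delta> \<preceq>\<^bsub>K\<^esub> N)))"

definition lowenheim_skolem_tarski :: "('v, 'f, 'r) abstract_class \<Rightarrow> bool" where
  "lowenheim_skolem_tarski K \<longleftrightarrow>
     (\<exists>\<mu> :: 'v rel. Card_order \<mu> \<and> \<mu> <o |UNIV :: 'v set| \<and>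
        ( |funs (Lang K)| +c |rels (Lang K)| ) +c natLeq \<le>o \<mu> \<and>
        (\<forall>M\<in>Cls K. \<forall>A\<subseteq>univ M. \<exists>M\<^sub>0. M\<^sub>0 \<preceq>\<^bsub>K\<^esub> M \<and> A \<subseteq> univ M\<^sub>0 \<and> |univ M\<^sub>0| \<le>o |A| +c \<mu>))"

definition aec :: "('v, 'f, 'r) abstract_class \<Rightarrow> bool" where
  "aec K \<longleftrightarrow>
     (\<forall>M\<in>Cls K. is_struct (Lang K) M) \<and>
     partial_order_on (Cls K) (Ord K) \<and>
     iso_closed K \<and>
     (\<forall>M N. M \<preceq>\<^bsub>K\<^esub> N \<longrightarrow> substruct (Lang K) M N) \<and>
     coherence K \<and> tarski_vaught K \<and> lowenheim_skolem_tarski K"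

definition K_embedding ::
  "('v, 'f, 'r) abstract_class \<Rightarrow> ('v \<Rightarrow> 'v) \<Rightarrow> ('v, 'f, 'r) struct \<Rightarrow> ('v, 'f, 'r) struct \<Rightarrow> bool" where
  "K_embedding K h M N \<longleftrightarrow> (\<exists>M'. struct_iso (Lang K) h M M' \<and> M' \<preceq>\<^bsub>K\<^esub> N)"


subsection \<open>Galois types\<close>

text \<open>
  A sequence is a partial function \<open>b\<close> with index set \<open>dom b\<close>; its restriction to \<open>I\<close> is
  \<open>b |` I\<close>, its image under \<open>h\<close> is \<open>map_option h \<circ> b\<close>, and its set of entries is \<open>ran b\<close>.
\<close>

type_synonym 'v sequence = "'v \<rightharpoonup> 'v"

type_synonym ('v, 'f, 'r) triple = "'v sequence \<times> 'v set \<times> ('v, 'f, 'r) struct"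

definition seqs :: "('v, 'f, 'r) struct \<Rightarrow> 'v sequence set" where
  "seqs N = {b. small (dom b) \<and> ran b \<subseteq> univ N}"

definition triples :: "('v, 'f, 'r) abstract_class \<Rightarrow> ('v, 'f, 'r) triple set" where
  "triples K = {(b, A, N). N \<in> Cls K \<and> A \<subseteq> univ N \<and> b \<in> seqs N}"

definition E_at :: "('v, 'f, 'r) abstract_class \<Rightarrow> ('v, 'f, 'r) triple rel" where
  "E_at K = {((b\<^sub>1, A\<^sub>1, N\<^sub>1), (b\<^sub>2, A\<^sub>2, N\<^sub>2)).
     (b\<^sub>1, A\<^sub>1, N\<^sub>1) \<in> triples K \<and> (b\<^sub>2, A\<^sub>2, N\<^sub>2) \<in> triples K \<and> A\<^sub>1 = A\<^sub>2 \<and>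
     (\<exists>N\<in>Cls K. \<exists>h\<^sub>1 h\<^sub>2. K_embedding K h\<^sub>1 N\<^sub>1 N \<and> K_embedding K h\<^sub>2 N\<^sub>2 N \<and>
        (\<forall>a\<in>A\<^sub>1. h\<^sub>1 a = a \<and> h\<^sub>2 a = a) \<and> map_option h\<^sub>1 \<circ> b\<^sub>1 = map_option h\<^sub>2 \<circ> b\<^sub>2)}"

definition gtp ::
  "('v, 'f, 'r) abstract_class \<Rightarrow> 'v sequence \<Rightarrow> 'v set \<Rightarrow> ('v, 'f, 'r) struct \<Rightarrow> ('v, 'f, 'r) triple set" where
  "gtp K b A N = (E_at K)\<^sup>+ `` {(b, A, N)}"

definition gS ::
  "('v, 'f, 'r) abstract_class \<Rightarrow> 'v rel \<Rightarrow> ('v, 'f, 'r) struct \<Rightarrow> ('v, 'f, 'r) triple set set" where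
  "gS K \<alpha> M = {gtp K b (univ M) N | b N. M \<preceq>\<^bsub>K\<^esub> N \<and> b \<in> seqs N \<and> dom b = Field \<alpha>}"

text \<open>
  The type \<open>p\<^sup>I \<restriction> A\<close>, with \<open>gtp K (b |` I) A N\<close> lifted to the equivalence class \<open>p\<close>;
  independence of the representative is shown below.
\<close>

definition gtp_restrict ::
  "('v, 'f, 'r) abstract_class \<Rightarrow> ('v, 'f, 'r) triple set \<Rightarrow> 'v set \<Rightarrow> 'v set \<Rightarrow> ('v, 'f, 'r) triple set" where
  "gtp_restrict K p I A = (\<Union>(b, B, N)\<in>p. gtp K (b |` I) A N)"

lemma sym_E_at: "sym (E_at K)"
proof (rule symI)
  fix t\<^sub>1 t\<^sub>2 assume *: "(t\<^sub>1, t\<^sub>2) \<in> E_at K"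
  obtain b\<^sub>1 A\<^sub>1 N\<^sub>1 b\<^sub>2 A\<^sub>2 N\<^sub>2 where t: "t\<^sub>1 = (b\<^sub>1, A\<^sub>1, N\<^sub>1)" "t\<^sub>2 = (b\<^sub>2, A\<^sub>2, N\<^sub>2)"
    by (cases t\<^sub>1, cases t\<^sub>2)
  from * show "(t\<^sub>2, t\<^sub>1) \<in> E_at K"
    unfolding E_at_def t mem_Collect_eq prod.case by metis
qed

lemma E_at_refl:
  assumes K: "aec K" and t: "t \<in> triples K"
  shows "(t, t) \<in> E_at K"
proof -
  obtain b A N where bAN: "t = (b, A, N)" by (cases t)
  have N: "N \<in> Cls K" using t bAN by (simp add: triples_def)
  have "refl_on (Cls K) (Ord K)"
    using K unfolding aec_def by (blast dest: partial_order_onD(1))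
  with N have "N \<preceq>\<^bsub>K\<^esub> N" by (simp add: refl_on_def)
  moreover have "struct_iso (Lang K) id N N" by (simp add: struct_iso_def)
  ultimately have "K_embedding K id N N" unfolding K_embedding_def by blast
  then show ?thesis
    using t N unfolding E_at_def bAN mem_Collect_eq prod.case by (metis id_apply)
qed

lemma gtp_eq_iff:
  assumes "aec K" "(b\<^sub>2, A\<^sub>2, N\<^sub>2) \<in> triples K"
  shows "gtp K b\<^sub>1 A\<^sub>1 N\<^sub>1 = gtp K b\<^sub>2 A\<^sub>2 N\<^sub>2 \<longleftrightarrow> ((b\<^sub>1, A\<^sub>1, N\<^sub>1), (b\<^sub>2, A\<^sub>2, N\<^sub>2)) \<in> (E_at K)\<^sup>+"
proof
  assume "gtp K b\<^sub>1 A\<^sub>1 N\<^sub>1 = gtp K b\<^sub>2 A\<^sub>2 N\<^sub>2"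
  then show "((b\<^sub>1, A\<^sub>1, N\<^sub>1), (b\<^sub>2, A\<^sub>2, N\<^sub>2)) \<in> (E_at K)\<^sup>+"
    using E_at_refl[OF assms] unfolding gtp_def by blast
next
  assume 1: "((b\<^sub>1, A\<^sub>1, N\<^sub>1), (b\<^sub>2, A\<^sub>2, N\<^sub>2)) \<in> (E_at K)\<^sup>+"
  then have 2: "((b\<^sub>2, A\<^sub>2, N\<^sub>2), (b\<^sub>1, A\<^sub>1, N\<^sub>1)) \<in> (E_at K)\<^sup>+"
    using sym_trancl[OF sym_E_at] by (rule symD[rotated])
  show "gtp K b\<^sub>1 A\<^sub>1 N\<^sub>1 = gtp K b\<^sub>2 A\<^sub>2 N\<^sub>2"
    unfolding gtp_def using trancl_trans[OF 1] trancl_trans[OF 2] by blast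
qed

lemma restrict_seqs:
  assumes "b \<in> seqs N"
  shows "b |` I \<in> seqs N"
proof -
  have "|dom (b |` I)| \<le>o |dom b|" by (rule card_of_mono1) auto
  moreover have "ran (b |` I) \<subseteq> ran b" by (auto simp: ran_def restrict_map_def split: if_splits)
  ultimately show ?thesis
    using assms unfolding seqs_def small_def by (blast intro: ordLeq_ordLess_trans)
qed

lemma E_at_restrict:
  assumes E: "((b\<^sub>1, B\<^sub>1, N\<^sub>1), (b\<^sub>2, B\<^sub>2, N\<^sub>2)) \<in> E_at K" and A: "A \<subseteq> B\<^sub>1"
  shows "((b\<^sub>1 |` I, A, N\<^sub>1), (b\<^sub>2 |` I, A, N\<^sub>2)) \<in> E_at K"
proof -
  have map: "map_option h \<circ> (b |` I) = (map_option h \<circ> b) |` I" for h :: "'a \<Rightarrow> 'a" and b :: "'a \<rightharpoonup> 'a"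
    by (rule ext) (simp add: restrict_map_def)
  from E obtain N h\<^sub>1 h\<^sub>2 where
    t: "(b\<^sub>1, B\<^sub>1, N\<^sub>1) \<in> triples K" "(b\<^sub>2, B\<^sub>1, N\<^sub>2) \<in> triples K" and
    N: "N \<in> Cls K" "K_embedding K h\<^sub>1 N\<^sub>1 N" "K_embedding K h\<^sub>2 N\<^sub>2 N" and
    h: "\<forall>a\<in>B\<^sub>1. h\<^sub>1 a = a \<and> h\<^sub>2 a = a" "map_option h\<^sub>1 \<circ> b\<^sub>1 = map_option h\<^sub>2 \<circ> b\<^sub>2"
    unfolding E_at_def by blast
  have "(b\<^sub>1 |` I, A, N\<^sub>1) \<in> triples K" "(b\<^sub>2 |` I, A, N\<^sub>2) \<in> triples K"
    using t A restrict_seqs unfolding triples_def by blast+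
  moreover have "\<forall>a\<in>A. h\<^sub>1 a = a \<and> h\<^sub>2 a = a" using h A by blast
  moreover have "map_option h\<^sub>1 \<circ> (b\<^sub>1 |` I) = map_option h\<^sub>2 \<circ> (b\<^sub>2 |` I)"
    unfolding map h(2) ..
  ultimately show ?thesis
    using N unfolding E_at_def mem_Collect_eq prod.case by blast
qed

lemma gtp_restrict_gtp:
  assumes K: "aec K" and t: "(b, B, N) \<in> triples K" and A: "A \<subseteq> B"
  shows "gtp_restrict K (gtp K b B N) I A = gtp K (b |` I) A N"
proof -
  have *: "((b |` I, A, N), (fst t |` I, A, snd (snd t))) \<in> (E_at K)\<^sup>+ \<and>
      A \<subseteq> fst (snd t) \<and> t \<in> triples K"
    if "((b, B, N), t) \<in> (E_at K)\<^sup>+" for t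
    using that
  proof (induction rule: trancl_induct)
    case (base y)
    obtain b' B' N' where y: "y = (b', B', N')" by (cases y)
    have "B' = B" "y \<in> triples K" using base y by (simp_all add: E_at_def)
    with y A E_at_restrict[OF base[unfolded y] A] show ?case by auto
  next
    case (step y z)
    obtain b1 B1 N1 b2 B2 N2 where yz: "y = (b1, B1, N1)" "z = (b2, B2, N2)"
      by (cases y, cases z)
    have A1: "A \<subseteq> B1" using step.IH yz by simp
    have "B1 = B2" "z \<in> triples K" using step.hyps(2) yz by (simp_all add: E_at_def)
    moreover have "((b1 |` I, A, N1), (b2 |` I, A, N2)) \<in> E_at K"
      using E_at_restrict[OF step.hyps(2)[unfolded yz] A1] .
    ultimately show ?case using step.IH yz A1 by (auto intro: trancl_into_trancl)
  qed
  have "gtp K (b' |` I) A N' = gtp K (b |` I) A N" if "(b', B', N') \<in> gtp K b B N" for b' B' N'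
  proof -
    have "((b |` I, A, N), (b' |` I, A, N')) \<in> (E_at K)\<^sup>+" "A \<subseteq> B'" "(b', B', N') \<in> triples K"
      using *[of "(b', B', N')"] that by (simp_all add: gtp_def)
    moreover from this have "(b' |` I, A, N') \<in> triples K"
      using restrict_seqs unfolding triples_def by blast
    ultimately show ?thesis using gtp_eq_iff[OF K] by metis
  qed
  moreover have "(b, B, N) \<in> gtp K b B N"
    using E_at_refl[OF K t] by (simp add: gtp_def r_into_trancl)
  ultimately show ?thesis unfolding gtp_restrict_def by blast
qed

definition fully_tame_short :: "('v, 'f, 'r) abstract_class \<Rightarrow> 'k rel \<Rightarrow> bool" where
  "fully_tame_short K \<kappa> \<longleftrightarrow>
     (\<forall>M\<in>Cls K. \<forall>\<alpha>. is_ordinal \<alpha> \<longrightarrow> (\<forall>p\<in>gS K \<alpha> M. \<forall>q\<in>gS K \<alpha> M. p \<noteq> q \<longrightarrow>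
        (\<exists>I A. I \<subseteq> Field \<alpha> \<and> A \<subseteq> univ M \<and> |I| +c |A| <o \<kappa> \<and>
           gtp_restrict K p I A \<noteq> gtp_restrict K q I A)))"


subsection \<open>Pseudo-universal classes\<close>

definition cl :: "('v, 'f, 'r) abstract_class \<Rightarrow> ('v, 'f, 'r) struct \<Rightarrow> 'v set \<Rightarrow> 'v set" where
  "cl K N A = \<Inter>{univ M | M. M \<preceq>\<^bsub>K\<^esub> N \<and> A \<subseteq> univ M}"

definition admits_intersections :: "('v, 'f, 'r) abstract_class \<Rightarrow> bool" where
  "admits_intersections K \<longleftrightarrow>
     (\<forall>N\<in>Cls K. \<forall>A\<subseteq>univ N. \<exists>M\<^sub>0. M\<^sub>0 \<preceq>\<^bsub>K\<^esub> N \<and> univ M\<^sub>0 = cl K N A)"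

abbreviation cl_struct ::
  "('v, 'f, 'r) abstract_class \<Rightarrow> ('v, 'f, 'r) struct \<Rightarrow> 'v set \<Rightarrow> ('v, 'f, 'r) struct" where
  "cl_struct K N A \<equiv> restrict_struct (Lang K) N (cl K N A)"

definition pseudo_universal :: "('v, 'f, 'r) abstract_class \<Rightarrow> bool" where
  "pseudo_universal K \<longleftrightarrow> admits_intersections K \<and>
     (\<forall>N\<^sub>1\<in>Cls K. \<forall>N\<^sub>2\<in>Cls K. \<forall>a\<^sub>1\<in>seqs N\<^sub>1. \<forall>a\<^sub>2\<in>seqs N\<^sub>2. \<forall>f g.
        gtp K a\<^sub>1 {} N\<^sub>1 = gtp K a\<^sub>2 {} N\<^sub>2 \<and>
        struct_iso (Lang K) f (cl_struct K N\<^sub>1 (ran a\<^sub>1)) (cl_struct K N\<^sub>2 (ran a\<^sub>2)) \<and>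
        struct_iso (Lang K) g (cl_struct K N\<^sub>1 (ran a\<^sub>1)) (cl_struct K N\<^sub>2 (ran a\<^sub>2)) \<and>
        map_option f \<circ> a\<^sub>1 = a\<^sub>2 \<and> map_option g \<circ> a\<^sub>1 = a\<^sub>2
        \<longrightarrow> (\<forall>x\<in>cl K N\<^sub>1 (ran a\<^sub>1). f x = g x))"

end

theory Submission
  imports Defs
begin

text \<open>
  In a class admitting intersections, two sequences have the same Galois type over \<open>A\<close> iff some
  isomorphism between the closures of \<open>A\<close> with each sequence fixes \<open>A\<close> and maps one sequence to the
  other.  If all finite restrictions of two types agree, this gives isomorphisms between the closures
  of the corresponding finite sets; pseudo-universality makes each of them unique, so they are
  compatible.  Closure has finite character, so their union is an isomorphism between the closures
  of the full sets.
\<close>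

subsection \<open>Isomorphisms of structures\<close>

text \<open>The uniqueness clause of pseudo-universality speaks of types over the empty set, while
  tameness concerns types over a base \<open>A\<close>. The base is therefore absorbed into the
  sequences: each \<open>a\<close> in \<open>A\<close> is paired with itself, and these pairs join
  the pairs of matching entries. The type equality demanded by the clause is then free, because an
  isomorphism of closures that matches two sequences already makes their types equal. Without
  uniqueness, isomorphisms picked for different finite sets need not cohere. Compatibility also
  rests on K-embeddings commuting with closure: an isomorphism for a larger finite set thereby
  restricts to one for a smaller set, and must be the one picked there. The bound
  \<open>natLeq\<close> reflects finite character of closure, which is where the chain axiom enters.
  Finite arities then let every atomic fact about the glued map be checked at one finite
  stage.\<close>

lemma fun_args_mapI:
  "xs \<in> fun_args L X f \<Longrightarrow> h ` X \<subseteq> Y \<Longrightarrow> map h xs \<in> fun_args L Y f"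
  by (auto simp: fun_args_def split: if_splits)

lemma rel_args_mapI:
  "xs \<in> rel_args L X R \<Longrightarrow> h ` X \<subseteq> Y \<Longrightarrow> map h xs \<in> rel_args L Y R"
  by (auto simp: rel_args_def split: if_splits)

lemma fun_args_subset: "xs \<in> fun_args L X f \<Longrightarrow> set xs \<subseteq> X"
  by (auto simp: fun_args_def split: if_splits)

lemma rel_args_subset: "xs \<in> rel_args L X R \<Longrightarrow> set xs \<subseteq> X"
  by (auto simp: rel_args_def split: if_splits)

lemma fun_args_change: "xs \<in> fun_args L X f \<Longrightarrow> set xs \<subseteq> Y \<Longrightarrow> xs \<in> fun_args L Y f"
  by (auto simp: fun_args_def split: if_splits)

lemma rel_args_change: "xs \<in> rel_args L X R \<Longrightarrow> set xs \<subseteq> Y \<Longrightarrow> xs \<in> rel_args L Y R"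
  by (auto simp: rel_args_def split: if_splits)

lemma struct_iso_image: "struct_iso L h M N \<Longrightarrow> h ` univ M = univ N"
  by (simp add: struct_iso_def bij_betw_def)

lemma struct_iso_inj: "struct_iso L h M N \<Longrightarrow> inj_on h (univ M)"
  by (simp add: struct_iso_def bij_betw_def)

lemma struct_iso_id: "struct_iso L id M M"
  by (simp add: struct_iso_def)

lemma struct_iso_comp:
  assumes g: "struct_iso L g M N" and h: "struct_iso L h N P"
  shows "struct_iso L (h \<circ> g) M P"
proof -
  have "g ` univ M \<subseteq> univ N" using struct_iso_image[OF g] by simp
  note mapI = fun_args_mapI[OF _ this] rel_args_mapI[OF _ this]
  have "bij_betw (h \<circ> g) (univ M) (univ P)"
    using g h unfolding struct_iso_def by (blast intro: bij_betw_trans)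
  moreover have "(h \<circ> g) (fun_interp M f xs) = fun_interp P f (map (h \<circ> g) xs)"
    if "xs \<in> fun_args L (univ M) f" for f xs
    using g h that mapI(1)[OF that] by (simp add: struct_iso_def)
  moreover have "rel_interp M R xs = rel_interp P R (map (h \<circ> g) xs)"
    if "xs \<in> rel_args L (univ M) R" for R xs
    using g h that mapI(2)[OF that] by (simp add: struct_iso_def)
  ultimately show ?thesis unfolding struct_iso_def by blast
qed

text \<open>Inverting \<open>h\<close> at a value of \<open>fun_interp M\<close> requires that value
  to lie in \<open>univ M\<close>; \<open>is_struct L M\<close> supplies this closure under
  functions.\<close>

lemma struct_iso_inv:
  assumes M: "is_struct L M" and h: "struct_iso L h M N"
  shows "struct_iso L (inv_into (univ M) h) N M"
proof -
  let ?g = "inv_into (univ M) h"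
  note im = struct_iso_image[OF h] and inj = struct_iso_inj[OF h]
  have g: "?g ` univ N \<subseteq> univ M" using im by (auto intro: inv_into_into)
  have mg: "map h (map ?g ys) = ys" if "set ys \<subseteq> univ N" for ys
    using that im by (induction ys) (auto simp: f_inv_into_f)
  have "?g (fun_interp N f ys) = fun_interp M f (map ?g ys)" if "ys \<in> fun_args L (univ N) f" for f ys
  proof -
    have xs: "map ?g ys \<in> fun_args L (univ M) f" using fun_args_mapI[OF that g] .
    then have "h (fun_interp M f (map ?g ys)) = fun_interp N f ys"
      using h mg[OF fun_args_subset[OF that]] unfolding struct_iso_def by metis
    moreover have "fun_interp M f (map ?g ys) \<in> univ M" using M xs by (simp add: is_struct_def)
    ultimately show ?thesis using inj by (metis inv_into_f_f)
  qed
  moreover have "rel_interp N R ys \<longleftrightarrow> rel_interp M R (map ?g ys)"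
    if "ys \<in> rel_args L (univ N) R" for R ys
    using h mg[OF rel_args_subset[OF that]] rel_args_mapI[OF that g]
    unfolding struct_iso_def by metis
  moreover have "bij_betw ?g (univ N) (univ M)"
    using h by (simp add: struct_iso_def bij_betw_inv_into)
  ultimately show ?thesis unfolding struct_iso_def by blast
qed

lemma univ_restrict_struct [simp]: "univ (restrict_struct L N X) = X"
  by (simp add: restrict_struct_def)

lemma restrict_restrict_struct:
  "X \<subseteq> Y \<Longrightarrow> restrict_struct L (restrict_struct L N Y) X = restrict_struct L N X"
  unfolding restrict_struct_def
  by (auto simp: fun_eq_iff fun_args_def rel_args_def)

lemma substruct_restrict_struct: "X \<subseteq> univ N \<Longrightarrow> substruct L (restrict_struct L N X) N"
  by (simp add: substruct_def restrict_struct_def)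

lemma struct_iso_restrict:
  assumes h: "struct_iso L h N N'" and X: "X \<subseteq> univ N"
  shows "struct_iso L h (restrict_struct L N X) (restrict_struct L N' (h ` X))"
  unfolding struct_iso_def
proof (intro conjI allI ballI)
  show "bij_betw h (univ (restrict_struct L N X)) (univ (restrict_struct L N' (h ` X)))"
    using struct_iso_inj[OF h] X by (auto simp: bij_betw_def intro: inj_on_subset)
next
  fix f xs assume "xs \<in> fun_args L (univ (restrict_struct L N X)) f"
  then have xs: "xs \<in> fun_args L X f" by simp
  moreover have "xs \<in> fun_args L (univ N) f"
    using xs fun_args_subset[OF xs] X by (blast intro: fun_args_change)
  moreover have "map h xs \<in> fun_args L (h ` X) f" using xs by (rule fun_args_mapI) simp
  ultimately show "h (fun_interp (restrict_struct L N X) f xs) =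
      fun_interp (restrict_struct L N' (h ` X)) f (map h xs)"
    using h by (simp add: restrict_struct_def struct_iso_def)
next
  fix R xs assume "xs \<in> rel_args L (univ (restrict_struct L N X)) R"
  then have xs: "xs \<in> rel_args L X R" by simp
  moreover have "xs \<in> rel_args L (univ N) R"
    using xs rel_args_subset[OF xs] X by (blast intro: rel_args_change)
  moreover have "map h xs \<in> rel_args L (h ` X) R" using xs by (rule rel_args_mapI) simp
  ultimately show "rel_interp (restrict_struct L N X) R xs =
      rel_interp (restrict_struct L N' (h ` X)) R (map h xs)"
    using h by (simp add: restrict_struct_def struct_iso_def)
qed

text \<open>Interpretations are normalised outside their proper domains, so agreement with
  \<open>N\<close> on \<open>univ M\<close> determines \<open>M\<close> as a record. Strong
  substructures of a fixed \<open>N\<close> can hence be handled through their universes.\<close>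

lemma substruct_eq_restrict_struct:
  assumes "is_struct L M" "substruct L M N"
  shows "M = restrict_struct L N (univ M)"
proof -
  have "fun_interp M f xs = fun_interp (restrict_struct L N (univ M)) f xs"
    "rel_interp M R xs = rel_interp (restrict_struct L N (univ M)) R xs" for f R xs
    using assms unfolding is_struct_def substruct_def restrict_struct_def
    by (cases "xs \<in> fun_args L (univ M) f", simp_all) (cases "xs \<in> rel_args L (univ M) R", simp_all)
  then show ?thesis by (intro struct.equality) (simp_all add: fun_eq_iff)
qed

lemma small_subset: "small B \<Longrightarrow> A \<subseteq> B \<Longrightarrow> small A"
  unfolding small_def by (blast intro: ordLeq_ordLess_trans card_of_mono1)

lemma small_image:
  fixes h :: "'v \<Rightarrow> 'v"
  shows "small A \<Longrightarrow> small (h ` A)"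
  unfolding small_def by (blast intro: ordLeq_ordLess_trans card_of_image)

text \<open>Closure under functions is inherited from \<open>M\<close> by lifting tuples along
  \<open>h\<close>; the default values come from \<open>N'\<close> being a restriction.\<close>

lemma is_struct_image:
  assumes M: "is_struct L M" and h: "struct_iso L h M N'" and N': "N' = restrict_struct L N Y"
  shows "is_struct L N'"
proof -
  note im = struct_iso_image[OF h]
  have Y: "univ N' = Y" using N' by simp
  have "small (univ N')" using M im small_image by (metis is_struct_def)
  moreover have "fun_interp N' f ys \<in> univ N'" if ys: "ys \<in> fun_args L (univ N') f" for f ys
  proof -
    have "set ys \<subseteq> h ` univ M" using fun_args_subset[OF ys] im by simp
    then have "ys \<in> lists (h ` univ M)" by (simp only: lists_eq_set mem_Collect_eq)
    then have "ys \<in> map h ` lists (univ M)" by (simp only: lists_image)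
    then obtain xs where xs: "ys = map h xs" "set xs \<subseteq> univ M" by (auto simp: lists_eq_set)
    then have "xs \<in> fun_args L (univ M) f" using ys by (auto simp: fun_args_def split: if_splits)
    then show ?thesis using M h im xs(1) unfolding struct_iso_def is_struct_def by (metis imageI)
  qed
  moreover have "\<forall>f xs. xs \<notin> fun_args L (univ N') f \<longrightarrow> fun_interp N' f xs = undefined"
    "\<forall>R xs. xs \<notin> rel_args L (univ N') R \<longrightarrow> \<not> rel_interp N' R xs"
    unfolding Y by (simp_all add: N' restrict_struct_def)
  ultimately show ?thesis unfolding is_struct_def by blast
qed


subsection \<open>Closures in classes admitting intersections\<close>

locale aec_with_intersections =
  fixes K :: "('v, 'f, 'r) abstract_class"
  assumes aec: "aec K" and intersections: "admits_intersections K"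
begin

abbreviation "L \<equiv> Lang K"

lemma Cls_is_struct: "M \<in> Cls K \<Longrightarrow> is_struct L M"
  using aec by (simp add: aec_def)

lemma strong_sub_refl: "M \<in> Cls K \<Longrightarrow> M \<preceq>\<^bsub>K\<^esub> M"
  using aec by (simp add: aec_def partial_order_on_def preorder_on_def refl_on_def)

lemma strong_sub_trans: "M \<preceq>\<^bsub>K\<^esub> N \<Longrightarrow> N \<preceq>\<^bsub>K\<^esub> P \<Longrightarrow> M \<preceq>\<^bsub>K\<^esub> P"
  using aec unfolding aec_def partial_order_on_def preorder_on_def by (blast dest: transD)

lemma strong_sub_Cls: "M \<preceq>\<^bsub>K\<^esub> N \<Longrightarrow> M \<in> Cls K" "M \<preceq>\<^bsub>K\<^esub> N \<Longrightarrow> N \<in> Cls K"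
  using aec unfolding aec_def partial_order_on_def preorder_on_def by blast+

lemma strong_sub_substruct: "M \<preceq>\<^bsub>K\<^esub> N \<Longrightarrow> substruct L M N"
  using aec by (simp add: aec_def)

lemma strong_sub_univ: "M \<preceq>\<^bsub>K\<^esub> N \<Longrightarrow> univ M \<subseteq> univ N"
  using strong_sub_substruct by (auto simp: substruct_def)

lemma strong_sub_eq_restrict: "M \<preceq>\<^bsub>K\<^esub> N \<Longrightarrow> restrict_struct L N (univ M) = M"
  using substruct_eq_restrict_struct Cls_is_struct strong_sub_Cls(1) strong_sub_substruct by metis

text \<open>Both structures are restrictions of \<open>N\<close>, so inclusion of universes already
  makes one a substructure of the other, as the coherence axiom requires.\<close>

lemma strong_sub_coherence:
  assumes "M\<^sub>0 \<preceq>\<^bsub>K\<^esub> N" "M\<^sub>1 \<preceq>\<^bsub>K\<^esub> N" "univ M\<^sub>0 \<subseteq> univ M\<^sub>1"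
  shows "M\<^sub>0 \<preceq>\<^bsub>K\<^esub> M\<^sub>1"
proof -
  have "M\<^sub>0 = restrict_struct L M\<^sub>1 (univ M\<^sub>0)"
    using assms strong_sub_eq_restrict restrict_restrict_struct by metis
  then have "substruct L M\<^sub>0 M\<^sub>1" using substruct_restrict_struct assms(3) by metis
  then show ?thesis using aec assms(1,2) unfolding aec_def coherence_def by blast
qed

text \<open>Serves to move closures along an embedding and, applied to the inverse isomorphism, back
  again.\<close>

lemma strong_sub_iso_image:
  assumes h: "struct_iso L h N N'" and N': "is_struct L N'" and M: "M \<preceq>\<^bsub>K\<^esub> N"
  shows "restrict_struct L N' (h ` univ M) \<preceq>\<^bsub>K\<^esub> N'"
proof -
  let ?M' = "restrict_struct L N' (h ` univ M)"
  have iso: "struct_iso L h M ?M'"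
    using struct_iso_restrict[OF h strong_sub_univ[OF M]] strong_sub_eq_restrict[OF M] by simp
  have "is_struct L ?M'"
    using is_struct_image[OF Cls_is_struct[OF strong_sub_Cls(1)[OF M]] iso] by simp
  moreover have "substruct L ?M' N'"
    using struct_iso_image[OF h] strong_sub_univ[OF M] by (intro substruct_restrict_struct) blast
  moreover have "\<forall>M N M' N' h. M \<preceq>\<^bsub>K\<^esub> N \<and> is_struct L M' \<and> is_struct L N' \<and>
      substruct L M' N' \<and> struct_iso L h N N' \<and> struct_iso L h M M' \<longrightarrow> M' \<preceq>\<^bsub>K\<^esub> N'"
    using aec unfolding aec_def iso_closed_def by blast
  ultimately show ?thesis using M N' h iso by blast
qed

lemma cl_least: "M \<preceq>\<^bsub>K\<^esub> N \<Longrightarrow> X \<subseteq> univ M \<Longrightarrow> cl K N X \<subseteq> univ M"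
  by (auto simp: cl_def)

lemma cl_superset: "X \<subseteq> cl K N X"
  by (auto simp: cl_def)

lemma cl_mono: "X \<subseteq> Y \<Longrightarrow> cl K N X \<subseteq> cl K N Y"
  unfolding cl_def by blast

text \<open>\<open>admits_intersections\<close> only asserts that some strong substructure has the
  closure as universe; by normalisation it is the restriction of \<open>N\<close>.\<close>

lemma cl_struct_strong_sub:
  assumes "N \<in> Cls K" "X \<subseteq> univ N"
  shows "cl_struct K N X \<preceq>\<^bsub>K\<^esub> N"
  using intersections assms strong_sub_eq_restrict unfolding admits_intersections_def by metis

lemma cl_struct_is_struct:
  "N \<in> Cls K \<Longrightarrow> X \<subseteq> univ N \<Longrightarrow> is_struct L (cl_struct K N X)"
  using Cls_is_struct cl_struct_strong_sub strong_sub_Cls(1) by blast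

lemma K_embedding_image:
  assumes "K_embedding K h M N"
  shows "h ` univ M \<subseteq> univ N"
  using assms strong_sub_univ struct_iso_image unfolding K_embedding_def by metis

lemma cl_image:
  assumes h: "K_embedding K h M N" and M: "M \<in> Cls K" and X: "X \<subseteq> univ M"
  shows "cl K N (h ` X) = h ` cl K M X"
proof
  obtain M' where iso: "struct_iso L h M M'" and M': "M' \<preceq>\<^bsub>K\<^esub> N"
    using h unfolding K_embedding_def by blast
  note sM' = Cls_is_struct[OF strong_sub_Cls(1)[OF M']]
  have C: "cl_struct K M X \<preceq>\<^bsub>K\<^esub> M" using cl_struct_strong_sub[OF M X] .
  have "restrict_struct L M' (h ` cl K M X) \<preceq>\<^bsub>K\<^esub> N"
    using strong_sub_trans[OF strong_sub_iso_image[OF iso sM' C] M'] by simp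
  then show "cl K N (h ` X) \<subseteq> h ` cl K M X"
    using cl_least[of _ N "h ` X"] cl_superset[of X M] by (metis image_mono univ_restrict_struct)
  let ?g = "inv_into (univ M) h"
  have hX: "h ` X \<subseteq> univ M'" using X struct_iso_image[OF iso] by blast
  have D: "cl_struct K N (h ` X) \<preceq>\<^bsub>K\<^esub> N"
    using cl_struct_strong_sub strong_sub_Cls(2)[OF M'] hX strong_sub_univ[OF M'] by blast
  \<comment> \<open>\<open>M'\<close> itself takes part in the intersection defining the closure in
    \<open>N\<close>, so the closure stays within the range of \<open>h\<close> and can be pulled
    back.\<close>
  have sub: "cl K N (h ` X) \<subseteq> univ M'" using cl_least[OF M' hX] .
  have "cl_struct K N (h ` X) \<preceq>\<^bsub>K\<^esub> M'"
    using strong_sub_coherence[OF D M'] sub by simp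
  then have "restrict_struct L M (?g ` cl K N (h ` X)) \<preceq>\<^bsub>K\<^esub> M"
    using strong_sub_iso_image[OF struct_iso_inv[OF Cls_is_struct[OF M] iso] Cls_is_struct[OF M]]
    by fastforce
  moreover have "X \<subseteq> ?g ` cl K N (h ` X)"
  proof
    fix x assume "x \<in> X"
    then have "h x \<in> cl K N (h ` X)" "?g (h x) = x"
      using cl_superset X struct_iso_inj[OF iso] by (blast, auto)
    then show "x \<in> ?g ` cl K N (h ` X)" by (metis imageI)
  qed
  ultimately have "cl K M X \<subseteq> ?g ` cl K N (h ` X)" using cl_least by (metis univ_restrict_struct)
  then have "h ` cl K M X \<subseteq> h ` ?g ` cl K N (h ` X)" by blast
  also have "\<dots> = cl K N (h ` X)"
    using sub struct_iso_image[OF iso] by (simp add: image_inv_into_cancel)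
  finally show "h ` cl K M X \<subseteq> cl K N (h ` X)" .
qed

text \<open>The target is cut out of \<open>N\<close> rather than of the image \<open>M'\<close>;
  the two restrictions coincide since \<open>M'\<close> is itself a restriction of
  \<open>N\<close>.\<close>

lemma cl_struct_iso:
  assumes h: "K_embedding K h M N" and M: "M \<in> Cls K" and X: "X \<subseteq> univ M"
  shows "struct_iso L h (cl_struct K M X) (cl_struct K N (h ` X))"
proof -
  obtain M' where iso: "struct_iso L h M M'" and M': "M' \<preceq>\<^bsub>K\<^esub> N"
    using h unfolding K_embedding_def by blast
  have sub: "cl K M X \<subseteq> univ M" using cl_least[OF strong_sub_refl[OF M] X] .
  have "restrict_struct L M' (h ` cl K M X) = restrict_struct L N (h ` cl K M X)"
    using restrict_restrict_struct[of "h ` cl K M X" "univ M'" L N]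
      strong_sub_eq_restrict[OF M'] sub struct_iso_image[OF iso] by auto
  then show ?thesis
    using struct_iso_restrict[OF iso sub] by (simp add: cl_image[OF assms])
qed

lemma K_embedding_id: "M \<preceq>\<^bsub>K\<^esub> N \<Longrightarrow> K_embedding K id M N"
  unfolding K_embedding_def using struct_iso_id by blast

lemma cl_strong_sub:
  assumes "M \<preceq>\<^bsub>K\<^esub> N" "X \<subseteq> univ M"
  shows "cl K N X = cl K M X"
  using cl_image[OF K_embedding_id[OF assms(1)] strong_sub_Cls(1)[OF assms(1)] assms(2)] by simp

lemma cl_struct_strong_sub_eq:
  assumes "M \<preceq>\<^bsub>K\<^esub> N" "X \<subseteq> univ M"
  shows "cl_struct K M X = cl_struct K N X"
  using restrict_restrict_struct[of "cl K N X" "univ M" L N] cl_least[OF assms]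
  by (simp add: cl_strong_sub[OF assms] strong_sub_eq_restrict[OF assms(1)])

text \<open>
  Induction on \<open>|X|\<close>: an infinite \<open>X\<close> is the union of its initial segments in a well-order of
  minimal type, all smaller than \<open>X\<close>, whose closures form a chain with union in \<open>K\<close>.
\<close>

lemma cl_finite_character:
  assumes N: "N \<in> Cls K" and X: "X \<subseteq> univ N"
  shows "cl K N X = (\<Union>F\<in>{F. finite F \<and> F \<subseteq> X}. cl K N F)"
proof
  show "(\<Union>F\<in>{F. finite F \<and> F \<subseteq> X}. cl K N F) \<subseteq> cl K N X" using cl_mono by blast
  have "wf (inv_image ordLess (card_of :: 'v set \<Rightarrow> 'v rel))" using wf_ordLess by (rule wf_inv_image)
  then show "cl K N X \<subseteq> (\<Union>F\<in>{F. finite F \<and> F \<subseteq> X}. cl K N F)"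
    using X
  proof (induction X rule: wf_induct_rule)
    case (less X)
    show ?case
    proof (cases "finite X")
      case True
      then show ?thesis by blast
    next
      case False
      let ?r = "|X|"
      define M where "M i = cl_struct K N (underS ?r i)" for i
      have co: "Card_order ?r" "Field ?r = X" "Well_order ?r"
        by (rule card_of_Card_order Field_card_of card_of_Well_order)+
      have inf: "infinite (Field ?r)" using False co(2) by simp
      have underS: "underS ?r i \<subseteq> X" for i using underS_Field[of _ ?r] co(2) by blast
      \<comment> \<open>An infinite cardinal has no last element. This makes the order a limit, and
        it also compensates for \<open>underS\<close> being strict: \<open>i\<close> is caught by
        the segment of some later \<open>j\<close>.\<close>
      have above: "\<exists>j\<in>X. j \<noteq> i \<and> (i, j) \<in> ?r" if "i \<in> X" for i
        using infinite_Card_order_limit[OF co(1) inf, of i] that co(2) by auto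
      have lim: "is_limit_ordinal ?r"
      proof -
        have "small X" using small_subset less.prems Cls_is_struct[OF N] unfolding is_struct_def by blast
        then show ?thesis using False above co
          unfolding is_limit_ordinal_def is_ordinal_def by auto
      qed
      have M: "M i \<preceq>\<^bsub>K\<^esub> N" for i
        unfolding M_def using cl_struct_strong_sub[OF N] underS less.prems by blast
      have chain: "M i \<preceq>\<^bsub>K\<^esub> M j" if "(i, j) \<in> ?r" for i j
      proof (rule strong_sub_coherence[OF M M])
        have "underS ?r i \<subseteq> underS ?r j"
          using that co(3) by (intro underS_incr) (auto simp: order_on_defs)
        then show "univ (M i) \<subseteq> univ (M j)" unfolding M_def by (simp add: cl_mono)
      qed
      have "union_struct L X M \<preceq>\<^bsub>K\<^esub> N"
      proof -
        have "tarski_vaught K" using aec by (simp add: aec_def)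
        then show ?thesis
          using lim M chain strong_sub_Cls(1)[OF M] N
          unfolding tarski_vaught_def Let_def by (metis co(2))
      qed
      moreover have "univ (union_struct L X M) = (\<Union>i\<in>X. cl K N (underS ?r i))"
        by (simp add: union_struct_def M_def)
      moreover have "X \<subseteq> (\<Union>i\<in>X. cl K N (underS ?r i))"
      proof
        fix i assume "i \<in> X"
        then obtain j where "j \<in> X" "i \<in> underS ?r j" using above unfolding underS_def by blast
        then show "i \<in> (\<Union>i\<in>X. cl K N (underS ?r i))" using cl_superset by blast
      qed
      ultimately have *: "cl K N X \<subseteq> (\<Union>i\<in>X. cl K N (underS ?r i))" using cl_least by metis
      have "cl K N (underS ?r i) \<subseteq> (\<Union>F\<in>{F. finite F \<and> F \<subseteq> X}. cl K N F)" if "i \<in> X" for i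
      proof -
        have "|underS ?r i| <o |X|"
          using card_of_underS[OF co(1)] that co(2) by simp
        then have "(underS ?r i, X) \<in> inv_image ordLess card_of" by simp
        moreover have "underS ?r i \<subseteq> univ N" using underS less.prems by blast
        ultimately have "cl K N (underS ?r i) \<subseteq>
            (\<Union>F\<in>{F. finite F \<and> F \<subseteq> underS ?r i}. cl K N F)"
          by (rule less.IH)
        also have "\<dots> \<subseteq> (\<Union>F\<in>{F. finite F \<and> F \<subseteq> X}. cl K N F)"
          using underS by (intro UN_mono) auto
        finally show ?thesis .
      qed
      with * show ?thesis by blast
    qed
  qed
qed

end

subsection \<open>Galois types and isomorphisms of closures\<close>

lemma ran_map_option_comp: "ran (map_option h \<circ> b) = h ` ran b"
  by (auto simp: ran_def)

lemma ran_restrict_map: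
  assumes "I \<subseteq> dom b"
  shows "ran (b |` I) = (\<lambda>i. the (b i)) ` I"
proof
  show "(\<lambda>i. the (b i)) ` I \<subseteq> ran (b |` I)"
    using assms by (auto simp: ran_def restrict_map_def subset_iff dom_def)
qed (force simp: ran_def restrict_map_def split: if_splits)

lemma map_option_comp_seqs:
  assumes "b \<in> seqs M" "h ` univ M \<subseteq> univ N"
  shows "map_option h \<circ> b \<in> seqs N"
proof -
  have "dom (map_option h \<circ> b) = dom b" by (auto simp: dom_def)
  moreover have "ran (map_option h \<circ> b) \<subseteq> univ N"
    using assms unfolding seqs_def ran_map_option_comp by blast
  ultimately show ?thesis using assms(1) by (simp only: seqs_def mem_Collect_eq)
qed

context aec_with_intersections
begin

text \<open>The target \<open>N\<close> serves as the common extension, with embeddings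
  \<open>h\<close> and \<open>id\<close>, so one step of \<open>E_at\<close> suffices.\<close>

lemma gtp_K_embedding:
  assumes h: "K_embedding K h M N" and t: "(b, A, M) \<in> triples K" and A: "\<And>a. a \<in> A \<Longrightarrow> h a = a"
  shows "gtp K b A M = gtp K (map_option h \<circ> b) A N"
proof -
  have N: "N \<in> Cls K" using h strong_sub_Cls(2) unfolding K_embedding_def by blast
  note im = K_embedding_image[OF h]
  have "A \<subseteq> univ N" using t im A unfolding triples_def by force
  then have t': "(map_option h \<circ> b, A, N) \<in> triples K"
    using t N map_option_comp_seqs[OF _ im] by (simp add: triples_def)
  have "map_option h \<circ> b = map_option id \<circ> (map_option h \<circ> b)" by (simp add: option.map_id0)
  then have "((b, A, M), (map_option h \<circ> b, A, N)) \<in> E_at K"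
    using t t' N h A K_embedding_id[OF strong_sub_refl[OF N]]
    unfolding E_at_def mem_Collect_eq prod.case by (metis id_apply)
  then show ?thesis using gtp_eq_iff[OF aec t'] by blast
qed

lemma struct_iso_cl_K_embedding:
  assumes "struct_iso L f M (cl_struct K N Y)" "N \<in> Cls K" "Y \<subseteq> univ N"
  shows "K_embedding K f M N"
  using assms cl_struct_strong_sub unfolding K_embedding_def by blast

text \<open>No common extension of \<open>N\<^sub>1\<close> and \<open>N\<^sub>2\<close> is built.
  The closure of \<open>X\<close> embeds into the first by inclusion and into the second by
  \<open>f\<close>, and the two equalities of types are chained through it.\<close>

lemma gtp_eq_if_cl_iso:
  assumes N1: "N\<^sub>1 \<in> Cls K" and N2: "N\<^sub>2 \<in> Cls K" and X: "X \<subseteq> univ N\<^sub>1" and Y: "Y \<subseteq> univ N\<^sub>2"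
    and f: "struct_iso L f (cl_struct K N\<^sub>1 X) (cl_struct K N\<^sub>2 Y)"
    and b: "small (dom b)" "A \<union> ran b \<subseteq> X" and A: "\<And>a. a \<in> A \<Longrightarrow> f a = a"
  shows "gtp K b A N\<^sub>1 = gtp K (map_option f \<circ> b) A N\<^sub>2"
proof -
  let ?C = "cl_struct K N\<^sub>1 X"
  have C: "?C \<preceq>\<^bsub>K\<^esub> N\<^sub>1" using cl_struct_strong_sub[OF N1 X] .
  have t: "(b, A, ?C) \<in> triples K"
    using b cl_superset[of X N\<^sub>1] strong_sub_Cls(1)[OF C] by (auto simp: triples_def seqs_def)
  have "gtp K b A ?C = gtp K (map_option id \<circ> b) A N\<^sub>1"
    using gtp_K_embedding[OF K_embedding_id[OF C] t] by simp
  moreover have "gtp K b A ?C = gtp K (map_option f \<circ> b) A N\<^sub>2"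
    using gtp_K_embedding[OF struct_iso_cl_K_embedding[OF f N2 Y] t] A by simp
  ultimately show ?thesis by (simp add: option.map_id0)
qed

text \<open>Inside the common extension the two generating sets have the same image, hence the
  images of their closures coincide as well. Going up along \<open>h\<^sub>1\<close> and down along
  the inverse of \<open>h\<^sub>2\<close> gives the isomorphism.\<close>

lemma E_at_cl_iso:
  assumes E: "((b\<^sub>1, A, N\<^sub>1), (b\<^sub>2, A, N\<^sub>2)) \<in> E_at K"
  shows "\<exists>f. struct_iso L f (cl_struct K N\<^sub>1 (A \<union> ran b\<^sub>1)) (cl_struct K N\<^sub>2 (A \<union> ran b\<^sub>2)) \<and>
    (\<forall>a\<in>A. f a = a) \<and> map_option f \<circ> b\<^sub>1 = b\<^sub>2"
proof -
  from E obtain N h\<^sub>1 h\<^sub>2 where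
    t: "(b\<^sub>1, A, N\<^sub>1) \<in> triples K" "(b\<^sub>2, A, N\<^sub>2) \<in> triples K" and
    N: "K_embedding K h\<^sub>1 N\<^sub>1 N" "K_embedding K h\<^sub>2 N\<^sub>2 N" and
    h: "\<forall>a\<in>A. h\<^sub>1 a = a \<and> h\<^sub>2 a = a" "map_option h\<^sub>1 \<circ> b\<^sub>1 = map_option h\<^sub>2 \<circ> b\<^sub>2"
    unfolding E_at_def by blast
  define X\<^sub>1 where "X\<^sub>1 = A \<union> ran b\<^sub>1"
  define X\<^sub>2 where "X\<^sub>2 = A \<union> ran b\<^sub>2"
  have X1: "N\<^sub>1 \<in> Cls K" "X\<^sub>1 \<subseteq> univ N\<^sub>1" and X2: "N\<^sub>2 \<in> Cls K" "X\<^sub>2 \<subseteq> univ N\<^sub>2"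
    using t by (auto simp: triples_def seqs_def X\<^sub>1_def X\<^sub>2_def)
  have "h\<^sub>1 ` ran b\<^sub>1 = h\<^sub>2 ` ran b\<^sub>2" using h(2) ran_map_option_comp by metis
  moreover have "h\<^sub>1 ` A = h\<^sub>2 ` A" using h(1) by auto
  ultimately have eq: "h\<^sub>1 ` X\<^sub>1 = h\<^sub>2 ` X\<^sub>2" unfolding X\<^sub>1_def X\<^sub>2_def image_Un by simp
  let ?g = "inv_into (cl K N\<^sub>2 X\<^sub>2) h\<^sub>2"
  have iso2: "struct_iso L h\<^sub>2 (cl_struct K N\<^sub>2 X\<^sub>2) (cl_struct K N (h\<^sub>2 ` X\<^sub>2))"
    using cl_struct_iso[OF N(2) X2] .
  have "struct_iso L ?g (cl_struct K N (h\<^sub>1 ` X\<^sub>1)) (cl_struct K N\<^sub>2 X\<^sub>2)"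
    using struct_iso_inv[OF cl_struct_is_struct[OF X2] iso2] eq by simp
  then have "struct_iso L (?g \<circ> h\<^sub>1) (cl_struct K N\<^sub>1 X\<^sub>1) (cl_struct K N\<^sub>2 X\<^sub>2)"
    using struct_iso_comp[OF cl_struct_iso[OF N(1) X1]] by blast
  moreover have gh: "?g (h\<^sub>2 x) = x" if "x \<in> X\<^sub>2" for x
    using that cl_superset[of X\<^sub>2 N\<^sub>2] struct_iso_inj[OF iso2] by (auto intro: inv_into_f_f)
  have "(?g \<circ> h\<^sub>1) a = a" if "a \<in> A" for a
    using gh[of a] h(1) that unfolding X\<^sub>2_def by simp
  moreover have "map_option (?g \<circ> h\<^sub>1) \<circ> b\<^sub>1 = b\<^sub>2"
  proof
    fix i
    have "map_option (?g \<circ> h\<^sub>1) (b\<^sub>1 i) = map_option ?g (map_option h\<^sub>1 (b\<^sub>1 i))"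
      by (simp add: option.map_comp)
    also have "\<dots> = map_option ?g (map_option h\<^sub>2 (b\<^sub>2 i))" using fun_cong[OF h(2), of i] by simp
    also have "\<dots> = b\<^sub>2 i" using gh by (cases "b\<^sub>2 i") (auto simp: X\<^sub>2_def ran_def)
    finally show "(map_option (?g \<circ> h\<^sub>1) \<circ> b\<^sub>1) i = b\<^sub>2 i" by simp
  qed
  ultimately show ?thesis unfolding X\<^sub>1_def X\<^sub>2_def by blast
qed

text \<open>
  Isomorphisms of closures compose, whereas amalgams need not: this is what makes the transitive
  closure in the definition of Galois types harmless.
\<close>

lemma gtp_eq_cl_iso:
  assumes t: "(b\<^sub>2, A, N\<^sub>2) \<in> triples K" and eq: "gtp K b\<^sub>1 A N\<^sub>1 = gtp K b\<^sub>2 A N\<^sub>2"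
  shows "\<exists>f. struct_iso L f (cl_struct K N\<^sub>1 (A \<union> ran b\<^sub>1)) (cl_struct K N\<^sub>2 (A \<union> ran b\<^sub>2)) \<and>
    (\<forall>a\<in>A. f a = a) \<and> map_option f \<circ> b\<^sub>1 = b\<^sub>2"
proof -
  have "fst (snd t) = A \<and> (\<exists>f. struct_iso L f (cl_struct K N\<^sub>1 (A \<union> ran b\<^sub>1))
      (cl_struct K (snd (snd t)) (A \<union> ran (fst t))) \<and> (\<forall>a\<in>A. f a = a) \<and> map_option f \<circ> b\<^sub>1 = fst t)"
    if "((b\<^sub>1, A, N\<^sub>1), t) \<in> (E_at K)\<^sup>+" for t
    using that
  proof (induction rule: trancl_induct)
    case (base t)
    obtain b A' N where t: "t = (b, A', N)" by (cases t)
    then have "A' = A" using base by (simp add: E_at_def)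
    then show ?case using E_at_cl_iso base unfolding t fst_conv snd_conv by blast
  next
    case (step t u)
    obtain b A' N c B P where tu: "t = (b, A', N)" "u = (c, B, P)" by (cases t, cases u)
    have A': "A' = A" "B = A" using step tu by (simp_all add: E_at_def)
    obtain f where f: "struct_iso L f (cl_struct K N\<^sub>1 (A \<union> ran b\<^sub>1)) (cl_struct K N (A \<union> ran b))"
        "\<forall>a\<in>A. f a = a" "map_option f \<circ> b\<^sub>1 = b"
      using step.IH unfolding tu fst_conv snd_conv by blast
    obtain g where g: "struct_iso L g (cl_struct K N (A \<union> ran b)) (cl_struct K P (A \<union> ran c))"
        "\<forall>a\<in>A. g a = a" "map_option g \<circ> b = c"
      using E_at_cl_iso step.hyps(2) tu A' by metis
    have "map_option (g \<circ> f) \<circ> b\<^sub>1 = c"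
      unfolding f(3)[symmetric] g(3)[symmetric] by (simp add: fun_eq_iff option.map_comp)
    moreover have "\<forall>a\<in>A. (g \<circ> f) a = a" using f(2) g(2) by simp
    ultimately show ?case
      using struct_iso_comp[OF f(1) g(1)] unfolding tu A' fst_conv snd_conv by blast
  qed
  then show ?thesis using gtp_eq_iff[OF aec t] eq by fastforce
qed

text \<open>
  A family of matching elements in two models, such as two sequences over a common base, is
  recorded by the relation \<open>S\<close> that pairs them.
\<close>

definition closure_iso ::
  "('v, 'f, 'r) struct \<Rightarrow> ('v, 'f, 'r) struct \<Rightarrow> ('v \<Rightarrow> 'v) \<Rightarrow> 'v rel \<Rightarrow> bool" where
  "closure_iso N\<^sub>1 N\<^sub>2 f S \<longleftrightarrow>
     struct_iso L f (cl_struct K N\<^sub>1 (Domain S)) (cl_struct K N\<^sub>2 (Range S)) \<and>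
     (\<forall>x y. (x, y) \<in> S \<longrightarrow> f x = y)"

lemma closure_iso_image:
  assumes "closure_iso N\<^sub>1 N\<^sub>2 f S" "T \<subseteq> S"
  shows "f ` Domain T = Range T"
proof -
  have "f x = y" if "(x, y) \<in> T" for x y using assms that unfolding closure_iso_def by blast
  then show ?thesis by force
qed

text \<open>\<open>f\<close> is a K-embedding of the closure of \<open>Domain S\<close> into
  \<open>N\<^sub>2\<close>, so it carries the closure of \<open>Domain T\<close> onto that of its
  image \<open>Range T\<close>. Computing the former inside the larger closure or in
  \<open>N\<^sub>1\<close> makes no difference.\<close>

lemma closure_iso_subset:
  assumes N1: "N\<^sub>1 \<in> Cls K" and N2: "N\<^sub>2 \<in> Cls K" and S: "S \<subseteq> univ N\<^sub>1 \<times> univ N\<^sub>2"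
    and f: "closure_iso N\<^sub>1 N\<^sub>2 f S" and T: "T \<subseteq> S"
  shows "closure_iso N\<^sub>1 N\<^sub>2 f T"
proof -
  let ?C = "cl_struct K N\<^sub>1 (Domain S)"
  have dom: "Domain S \<subseteq> univ N\<^sub>1" "Range S \<subseteq> univ N\<^sub>2" using S by auto
  have C: "?C \<preceq>\<^bsub>K\<^esub> N\<^sub>1" using cl_struct_strong_sub[OF N1 dom(1)] .
  have T': "Domain T \<subseteq> univ ?C"
    using T cl_superset[of "Domain S" N\<^sub>1] by (auto dest: Domain_mono)
  have "K_embedding K f ?C N\<^sub>2"
    using f struct_iso_cl_K_embedding N2 dom(2) unfolding closure_iso_def by blast
  from cl_struct_iso[OF this strong_sub_Cls(1)[OF C] T']
  have "struct_iso L f (cl_struct K N\<^sub>1 (Domain T)) (cl_struct K N\<^sub>2 (Range T))"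
    unfolding cl_struct_strong_sub_eq[OF C T'] closure_iso_image[OF f T] .
  then show ?thesis using f T unfolding closure_iso_def by blast
qed

end

section \<open>Uniqueness and gluing of closure isomorphisms in pseudo-universal classes\<close>

locale pseudo_universal_aec = aec_with_intersections K
  for K :: "('v, 'f, 'r) abstract_class" +
  assumes pseudo_universal: "pseudo_universal K"
begin

text \<open>The only use of the uniqueness clause in \<open>pseudo_universal\<close>. Its premise on
  types is no extra demand: \<open>f\<close> itself yields it through
  \<open>gtp_eq_if_cl_iso\<close>.\<close>

lemma closure_iso_unique:
  assumes N1: "N\<^sub>1 \<in> Cls K" and N2: "N\<^sub>2 \<in> Cls K" and S: "S \<subseteq> univ N\<^sub>1 \<times> univ N\<^sub>2"
    and f: "closure_iso N\<^sub>1 N\<^sub>2 f S" and g: "closure_iso N\<^sub>1 N\<^sub>2 g S" and x: "x \<in> cl K N\<^sub>1 (Domain S)"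
  shows "f x = g x"
proof -
  have dom: "Domain S \<subseteq> univ N\<^sub>1" "Range S \<subseteq> univ N\<^sub>2" using S by auto
  \<comment> \<open>Sequences are indexed by elements of \<open>'v\<close>, so
    \<open>Domain S\<close> can enumerate itself.\<close>
  define a\<^sub>1 where "a\<^sub>1 = (\<lambda>x. if x \<in> Domain S then Some x else None)"
  define a\<^sub>2 where "a\<^sub>2 = map_option f \<circ> a\<^sub>1"
  have a1: "ran a\<^sub>1 = Domain S" "dom a\<^sub>1 = Domain S"
    by (auto simp: a\<^sub>1_def ran_def dom_def split: if_splits)
  have small: "small (dom a\<^sub>1)"
    using small_subset[OF _ dom(1)] Cls_is_struct[OF N1] a1 by (simp add: is_struct_def)
  have a2: "ran a\<^sub>2 = Range S" "dom a\<^sub>2 = Domain S"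
    using a1 closure_iso_image[OF f] by (auto simp: a\<^sub>2_def ran_map_option_comp dom_def)
  have "a\<^sub>1 \<in> seqs N\<^sub>1" "a\<^sub>2 \<in> seqs N\<^sub>2" using a1 a2 small dom by (simp_all add: seqs_def)
  moreover have "gtp K a\<^sub>1 {} N\<^sub>1 = gtp K a\<^sub>2 {} N\<^sub>2"
    using gtp_eq_if_cl_iso[OF N1 N2 dom, of f a\<^sub>1 "{}"] f a1 small unfolding a\<^sub>2_def closure_iso_def by simp
  moreover have "map_option g \<circ> a\<^sub>1 = a\<^sub>2"
    using f g by (fastforce simp: a\<^sub>1_def a\<^sub>2_def closure_iso_def)
  ultimately show ?thesis
    using pseudo_universal N1 N2 f g x a1 a2 a\<^sub>2_def
    unfolding pseudo_universal_def closure_iso_def by metis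
qed

text \<open>The isomorphisms for finite \<open>S\<close> are arbitrary choices; uniqueness turns
  them into a compatible system, directed under union.\<close>

lemma closure_iso_glue:
  assumes N1: "N\<^sub>1 \<in> Cls K" and N2: "N\<^sub>2 \<in> Cls K" and R: "R \<subseteq> univ N\<^sub>1 \<times> univ N\<^sub>2"
    and fin: "\<And>S. finite S \<Longrightarrow> S \<subseteq> R \<Longrightarrow> \<exists>f. closure_iso N\<^sub>1 N\<^sub>2 f S"
  shows "\<exists>f. closure_iso N\<^sub>1 N\<^sub>2 f R"
proof -
  define P where "P S \<longleftrightarrow> finite S \<and> S \<subseteq> R" for S
  define C where "C S = cl K N\<^sub>1 (Domain S)" for S :: "'v rel"
  define D where "D S = cl K N\<^sub>2 (Range S)" for S :: "'v rel"
  have P_Un: "P (S \<union> T)" if "P S" "P T" for S T using that by (simp add: P_def)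
  have C_mono: "C S \<subseteq> C T" if "S \<subseteq> T" for S T
    unfolding C_def using that by (intro cl_mono Domain_mono)
  obtain F where F: "closure_iso N\<^sub>1 N\<^sub>2 (F S) S" if "P S" for S
    using fin unfolding P_def by metis
  \<comment> \<open>\<open>F T\<close> restricts to an isomorphism for \<open>S\<close>, which
    uniqueness identifies with \<open>F S\<close>.\<close>
  have agree: "F S x = F T x" if "P T" "S \<subseteq> T" "x \<in> C S" for S T x
  proof -
    have "P S" using that by (auto simp: P_def intro: finite_subset)
    moreover have "T \<subseteq> univ N\<^sub>1 \<times> univ N\<^sub>2" using that R by (auto simp: P_def)
    ultimately show ?thesis
      using closure_iso_unique[OF N1 N2 _ F[of S] closure_iso_subset[OF N1 N2 _ F[of T] that(2)]]
        that unfolding C_def by blast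
  qed
  have dom: "Domain R \<subseteq> univ N\<^sub>1" "Range R \<subseteq> univ N\<^sub>2" using R by auto
  have cover: "\<exists>S. P S \<and> x \<in> C S" if x: "x \<in> C R" for x
  proof -
    obtain G where G: "finite G" "G \<subseteq> fst ` R" "x \<in> cl K N\<^sub>1 G"
      using x cl_finite_character[OF N1 dom(1)] unfolding C_def Domain_fst by blast
    with finite_subset_image[of G fst R] show ?thesis by (auto simp: P_def C_def Domain_fst)
  qed
  \<comment> \<open>Surjectivity of the glued map needs finite character in \<open>N\<^sub>2\<close>
    as well.\<close>
  have cover_D: "\<exists>S. P S \<and> y \<in> D S" if y: "y \<in> D R" for y
  proof -
    obtain G where G: "finite G" "G \<subseteq> snd ` R" "y \<in> cl K N\<^sub>2 G"
      using y cl_finite_character[OF N2 dom(2)] unfolding D_def Range_snd by blast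
    with finite_subset_image[of G snd R] show ?thesis by (auto simp: P_def D_def Range_snd)
  qed
  \<comment> \<open>Arities are finite and the stages are directed, so a whole tuple fits into one
    stage; injectivity uses this for a pair.\<close>
  have cover_list: "\<exists>S. P S \<and> set xs \<subseteq> C S" if "set xs \<subseteq> C R" for xs
    using that
  proof (induction xs)
    case Nil
    have "P {}" by (simp add: P_def)
    then show ?case by auto
  next
    case (Cons x xs)
    then obtain S where S: "P S" "set xs \<subseteq> C S" by auto
    obtain T where T: "P T" "x \<in> C T" using cover Cons.prems by auto
    have "x \<in> C (S \<union> T)" "set xs \<subseteq> C (S \<union> T)"
      using S T C_mono[of S "S \<union> T"] C_mono[of T "S \<union> T"] by auto
    then show ?case using P_Un[OF S(1) T(1)] by auto
  qed
  \<comment> \<open>The stage picked by \<open>SOME\<close> is immaterial: any two stages containing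
    \<open>x\<close> are compared inside their union.\<close>
  define f where "f x = F (SOME S. P S \<and> x \<in> C S) x" for x
  have f: "f x = F S x" if "P S" "x \<in> C S" for S x
  proof -
    define T where "T = (SOME S. P S \<and> x \<in> C S)"
    have T: "P T \<and> x \<in> C T" unfolding T_def by (rule someI) (use that in blast)
    have "F T x = F (S \<union> T) x" "F S x = F (S \<union> T) x"
      using agree[of "S \<union> T"] P_Un that T by blast+
    then show ?thesis unfolding f_def T_def[symmetric] by simp
  qed
  have C_sub: "C S \<subseteq> C R" "D S \<subseteq> D R" if "P S" for S
    using that cl_mono[OF Domain_mono[of S R]] cl_mono[OF Range_mono[of S R]]
    by (auto simp: P_def C_def D_def)
  have iso: "struct_iso L f (cl_struct K N\<^sub>1 (Domain R)) (cl_struct K N\<^sub>2 (Range R))"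
  proof -
    have FS: "struct_iso L (F S) (restrict_struct L N\<^sub>1 (C S)) (restrict_struct L N\<^sub>2 (D S))"
      if "P S" for S using F[OF that] by (simp add: closure_iso_def C_def D_def)
    have FS_bij: "inj_on (F S) (C S)" "F S ` C S = D S" if "P S" for S
      using struct_iso_inj[OF FS[OF that]] struct_iso_image[OF FS[OF that]] by simp_all
    have f_map: "map f xs = map (F S) xs" if "P S" "set xs \<subseteq> C S" for S xs
      using that f by (auto simp: subset_iff)
    have "inj_on f (C R)"
    proof (rule inj_onI)
      fix x y assume xy: "x \<in> C R" "y \<in> C R" "f x = f y"
      then obtain S where "P S" "x \<in> C S" "y \<in> C S" using cover_list[of "[x, y]"] by auto
      then show "x = y" using xy(3) f FS_bij(1) by (metis inj_onD)
    qed
    moreover have "f ` C R = D R"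
    proof
      show "f ` C R \<subseteq> D R"
      proof
        fix y assume "y \<in> f ` C R"
        then obtain x where x: "x \<in> C R" "y = f x" by blast
        then obtain S where S: "P S" "x \<in> C S" using cover by blast
        then have "y \<in> D S" using x(2) f[OF S] FS_bij(2)[OF S(1)] by blast
        then show "y \<in> D R" using C_sub(2)[OF S(1)] by blast
      qed
      show "D R \<subseteq> f ` C R"
      proof
        fix y assume "y \<in> D R"
        then obtain S where S: "P S" "y \<in> D S" using cover_D by blast
        then obtain x where "x \<in> C S" "y = F S x" using FS_bij(2)[OF S(1)] by blast
        then show "y \<in> f ` C R" using f S(1) C_sub(1)[OF S(1)] by (metis imageI subsetD)
      qed
    qed
    moreover have "f (fun_interp (restrict_struct L N\<^sub>1 (C R)) s xs) =
        fun_interp (restrict_struct L N\<^sub>2 (D R)) s (map f xs)" if xs: "xs \<in> fun_args L (C R) s" for s xs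
    proof -
      obtain S where S: "P S" "set xs \<subseteq> C S" using cover_list fun_args_subset[OF xs] by blast
      have xsS: "xs \<in> fun_args L (C S) s" using xs S(2) by (rule fun_args_change)
      have "map f xs \<in> fun_args L (D S) s"
        unfolding f_map[OF S] using xsS FS_bij(2)[OF S(1)] by (intro fun_args_mapI) auto
      moreover from this have "map f xs \<in> fun_args L (D R) s"
        using C_sub(2)[OF S(1)] by (auto intro: fun_args_change dest: fun_args_subset)
      \<comment> \<open>The value must lie in the stage too, so that \<open>f\<close> may be
        replaced by \<open>F S\<close> there and not only at the arguments.\<close>
      moreover have "fun_interp (restrict_struct L N\<^sub>1 (C S)) s xs \<in> C S"
      proof -
        have "Domain S \<subseteq> univ N\<^sub>1" using S(1) dom(1) by (auto simp: P_def)
        from cl_struct_is_struct[OF N1 this] xsS show ?thesis by (simp add: is_struct_def C_def)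
      qed
      ultimately show ?thesis
        unfolding f_map[OF S] using FS[OF S(1)] xs xsS f[OF S(1)]
        by (simp add: struct_iso_def restrict_struct_def)
    qed
    moreover have "rel_interp (restrict_struct L N\<^sub>1 (C R)) s xs =
        rel_interp (restrict_struct L N\<^sub>2 (D R)) s (map f xs)" if xs: "xs \<in> rel_args L (C R) s" for s xs
    proof -
      obtain S where S: "P S" "set xs \<subseteq> C S" using cover_list rel_args_subset[OF xs] by blast
      have xsS: "xs \<in> rel_args L (C S) s" using xs S(2) by (rule rel_args_change)
      have "map f xs \<in> rel_args L (D S) s"
        unfolding f_map[OF S] using xsS FS_bij(2)[OF S(1)] by (intro rel_args_mapI) auto
      moreover from this have "map f xs \<in> rel_args L (D R) s"
        using C_sub(2)[OF S(1)] by (auto intro: rel_args_change dest: rel_args_subset)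
      ultimately show ?thesis
        unfolding f_map[OF S] using FS[OF S(1)] xs xsS by (simp add: struct_iso_def restrict_struct_def)
    qed
    ultimately show ?thesis
      unfolding struct_iso_def bij_betw_def univ_restrict_struct C_def D_def by blast
  qed
  moreover have "f x = y" if "(x, y) \<in> R" for x y
  proof -
    have P: "P {(x, y)}" using that by (simp add: P_def)
    moreover have "x \<in> C {(x, y)}" using cl_superset[of "{x}" N\<^sub>1] by (simp add: C_def)
    ultimately show ?thesis using f F[OF P] by (simp add: closure_iso_def)
  qed
  ultimately show ?thesis unfolding closure_iso_def by blast
qed

text \<open>The contrapositive gives both properties at once: shrinking the index set is shortness,
  shrinking the base is tameness.\<close>

lemma gtp_eq_if_finite_restrictions_eq:
  assumes t1: "(b\<^sub>1, A, N\<^sub>1) \<in> triples K" and t2: "(b\<^sub>2, A, N\<^sub>2) \<in> triples K"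
    and dom: "dom b\<^sub>1 = dom b\<^sub>2"
    and eq: "\<And>I B. finite I \<Longrightarrow> I \<subseteq> dom b\<^sub>1 \<Longrightarrow> finite B \<Longrightarrow> B \<subseteq> A \<Longrightarrow>
      gtp K (b\<^sub>1 |` I) B N\<^sub>1 = gtp K (b\<^sub>2 |` I) B N\<^sub>2"
  shows "gtp K b\<^sub>1 A N\<^sub>1 = gtp K b\<^sub>2 A N\<^sub>2"
proof -
  have N1: "N\<^sub>1 \<in> Cls K" and N2: "N\<^sub>2 \<in> Cls K" and A: "A \<subseteq> univ N\<^sub>1" "A \<subseteq> univ N\<^sub>2"
    and b: "b\<^sub>1 \<in> seqs N\<^sub>1" "b\<^sub>2 \<in> seqs N\<^sub>2"
    using t1 t2 by (auto simp: triples_def)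
  \<comment> \<open>Pairing base elements with themselves makes any matching map fix
    \<open>B\<close>. Entries may repeat or lie in the base, so this is not visibly the graph of a
    function; hence a relation.\<close>
  define R where "R I B = (\<lambda>a. (a, a)) ` B \<union> (\<lambda>i. (the (b\<^sub>1 i), the (b\<^sub>2 i))) ` I" for I B
  have dom_R: "Domain (R I B) = B \<union> ran (b\<^sub>1 |` I)" "Range (R I B) = B \<union> ran (b\<^sub>2 |` I)"
    if "I \<subseteq> dom b\<^sub>1" for I B
    using that ran_restrict_map[of I b\<^sub>1] ran_restrict_map[of I b\<^sub>2] dom
    by (simp_all add: R_def Domain_fst Range_snd image_Un image_image)
  have R_sub: "R I B \<subseteq> univ N\<^sub>1 \<times> univ N\<^sub>2" if "I \<subseteq> dom b\<^sub>1" "B \<subseteq> A" for I B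
  proof -
    have "ran (b\<^sub>1 |` I) \<subseteq> univ N\<^sub>1" "ran (b\<^sub>2 |` I) \<subseteq> univ N\<^sub>2"
      using b[THEN restrict_seqs] unfolding seqs_def by blast+
    then have "Domain (R I B) \<subseteq> univ N\<^sub>1" "Range (R I B) \<subseteq> univ N\<^sub>2"
      unfolding dom_R[OF that(1)] using that(2) A by blast+
    then show ?thesis by (auto simp: subset_iff)
  qed
  have R_iso: "\<exists>f. closure_iso N\<^sub>1 N\<^sub>2 f (R I B)"
    if I: "finite I" "I \<subseteq> dom b\<^sub>1" and B: "finite B" "B \<subseteq> A" for I B
  proof -
    have "(b\<^sub>2 |` I, B, N\<^sub>2) \<in> triples K" using t2 B restrict_seqs by (auto simp: triples_def)
    from gtp_eq_cl_iso[OF this eq[OF I B]] obtain f where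
      f: "struct_iso L f (cl_struct K N\<^sub>1 (Domain (R I B))) (cl_struct K N\<^sub>2 (Range (R I B)))"
        "\<forall>a\<in>B. f a = a" "map_option f \<circ> (b\<^sub>1 |` I) = b\<^sub>2 |` I"
      unfolding dom_R[OF I(2)] by blast
    have "f (the (b\<^sub>1 i)) = the (b\<^sub>2 i)" if "i \<in> I" for i
    proof -
      have "b\<^sub>1 i \<noteq> None" using that I(2) by blast
      then show ?thesis
        using fun_cong[OF f(3), of i] that by (simp flip: option.map_sel)
    qed
    then have "\<forall>x y. (x, y) \<in> R I B \<longrightarrow> f x = y" using f(2) by (auto simp: R_def)
    then show ?thesis using f(1) unfolding closure_iso_def by blast
  qed
  have "\<exists>f. closure_iso N\<^sub>1 N\<^sub>2 f (R (dom b\<^sub>1) A)"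
  proof (rule closure_iso_glue[OF N1 N2 R_sub])
    fix S assume S: "finite S" "S \<subseteq> R (dom b\<^sub>1) A"
    \<comment> \<open>Gluing asks for arbitrary finite subsets, whereas \<open>R_iso\<close> covers
      those of the form \<open>R I B\<close>. Intersecting \<open>S\<close> with each half of the
      full relation, and lifting each finite part to finitely many indices, shows that every
      \<open>S\<close> has this form.\<close>
    have "\<exists>I B. finite I \<and> I \<subseteq> dom b\<^sub>1 \<and> finite B \<and> B \<subseteq> A \<and> S = R I B"
    proof -
      let ?d = "\<lambda>a. (a, a)" and ?e = "\<lambda>i. (the (b\<^sub>1 i), the (b\<^sub>2 i))"
      have "\<exists>B\<subseteq>A. finite B \<and> S \<inter> ?d ` A = ?d ` B"
        by (rule finite_subset_image) (simp_all add: S(1))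
      then obtain B where B: "B \<subseteq> A" "finite B" "S \<inter> ?d ` A = ?d ` B" by (elim exE conjE)
      have "\<exists>I\<subseteq>dom b\<^sub>1. finite I \<and> S \<inter> ?e ` dom b\<^sub>1 = ?e ` I"
        by (rule finite_subset_image) (simp_all add: S(1))
      then obtain I where I: "I \<subseteq> dom b\<^sub>1" "finite I" "S \<inter> ?e ` dom b\<^sub>1 = ?e ` I" by (elim exE conjE)
      have "S = R I B"
        using S(2) unfolding R_def I(3)[symmetric] B(3)[symmetric] Int_Un_distrib[symmetric]
        by (rule Int_absorb2[symmetric])
      with I(1,2) B(1,2) show ?thesis by (intro exI conjI)
    qed
    then show "\<exists>f. closure_iso N\<^sub>1 N\<^sub>2 f S" using R_iso by blast
  qed simp_all
  then obtain f where f: "closure_iso N\<^sub>1 N\<^sub>2 f (R (dom b\<^sub>1) A)" by blast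
  have fR: "f x = y" if "(x, y) \<in> R (dom b\<^sub>1) A" for x y
    using f that unfolding closure_iso_def by blast
  have fb: "map_option f \<circ> b\<^sub>1 = b\<^sub>2"
  proof
    fix i
    show "(map_option f \<circ> b\<^sub>1) i = b\<^sub>2 i"
    proof (cases "i \<in> dom b\<^sub>1")
      case True
      then have "f (the (b\<^sub>1 i)) = the (b\<^sub>2 i)" by (intro fR) (simp add: R_def)
      moreover obtain x y where "b\<^sub>1 i = Some x" "b\<^sub>2 i = Some y" using True dom by (metis domD)
      ultimately show ?thesis by simp
    next
      case False
      then have "b\<^sub>1 i = None" "b\<^sub>2 i = None" using dom by blast+
      then show ?thesis by simp
    qed
  qed
  have fa: "f a = a" if "a \<in> A" for a using that by (intro fR) (simp add: R_def)
  have small: "small (dom b\<^sub>1)" using b by (simp add: seqs_def)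
  have dom_sub: "Domain (R (dom b\<^sub>1) A) \<subseteq> univ N\<^sub>1" "Range (R (dom b\<^sub>1) A) \<subseteq> univ N\<^sub>2"
    using R_sub[of "dom b\<^sub>1" A] by auto
  have "b\<^sub>1 |` dom b\<^sub>1 = b\<^sub>1" by (auto simp: restrict_map_def fun_eq_iff dom_def)
  then have sub: "A \<union> ran b\<^sub>1 \<subseteq> Domain (R (dom b\<^sub>1) A)"
    using dom_R(1)[of "dom b\<^sub>1" A] by simp
  have "struct_iso L f (cl_struct K N\<^sub>1 (Domain (R (dom b\<^sub>1) A)))
      (cl_struct K N\<^sub>2 (Range (R (dom b\<^sub>1) A)))"
    using f by (simp add: closure_iso_def)
  from gtp_eq_if_cl_iso[OF N1 N2 dom_sub this small sub fa] show ?thesis unfolding fb .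
qed

end

theorem theorem3p7:
  fixes K :: "('v, 'f, 'r) abstract_class"
  assumes "aec K"
    and "pseudo_universal K"
  shows "fully_tame_short K natLeq"
proof -
  interpret pseudo_universal_aec K
    using assms by unfold_locales (simp_all add: pseudo_universal_def)
  show ?thesis
    unfolding fully_tame_short_def
  proof (intro ballI allI impI)
    fix M p q and \<alpha> :: "'v rel"
    assume pq: "p \<in> gS K \<alpha> M" "q \<in> gS K \<alpha> M" "p \<noteq> q"
    obtain b\<^sub>1 N\<^sub>1 where p: "p = gtp K b\<^sub>1 (univ M) N\<^sub>1" "M \<preceq>\<^bsub>K\<^esub> N\<^sub>1" "b\<^sub>1 \<in> seqs N\<^sub>1" "dom b\<^sub>1 = Field \<alpha>"
      using pq(1) unfolding gS_def by blast
    obtain b\<^sub>2 N\<^sub>2 where q: "q = gtp K b\<^sub>2 (univ M) N\<^sub>2" "M \<preceq>\<^bsub>K\<^esub> N\<^sub>2" "b\<^sub>2 \<in> seqs N\<^sub>2" "dom b\<^sub>2 = Field \<alpha>"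
      using pq(2) unfolding gS_def by blast
    have t: "(b\<^sub>1, univ M, N\<^sub>1) \<in> triples K" "(b\<^sub>2, univ M, N\<^sub>2) \<in> triples K"
      using p q strong_sub_Cls(2) strong_sub_univ by (simp_all add: triples_def)
    obtain I B where IB: "finite I" "I \<subseteq> Field \<alpha>" "finite B" "B \<subseteq> univ M"
      and neq: "gtp K (b\<^sub>1 |` I) B N\<^sub>1 \<noteq> gtp K (b\<^sub>2 |` I) B N\<^sub>2"
      using gtp_eq_if_finite_restrictions_eq[OF t] p q pq(3) by metis
    have "|I| +c |B| <o natLeq"
      using IB by (simp add: csum_def finite_iff_ordLess_natLeq[symmetric] Field_card_of)
    \<comment> \<open>Restriction is defined on whole classes; \<open>gtp_restrict_gtp\<close>
      evaluates it at the chosen representatives.\<close>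
    moreover have "gtp_restrict K p I B \<noteq> gtp_restrict K q I B"
      using neq gtp_restrict_gtp[OF aec t(1) IB(4)] gtp_restrict_gtp[OF aec t(2) IB(4)] p q by simp
    ultimately show "\<exists>I A. I \<subseteq> Field \<alpha> \<and> A \<subseteq> univ M \<and> |I| +c |A| <o natLeq \<and>
        gtp_restrict K p I A \<noteq> gtp_restrict K q I A"
      using IB by blast
  qed
qed

end
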